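(* Let $\mathcal{A}=(a_n)_{n\in\mathbb{N}_+}$ be a sequence of positive integers, $k\in\mathbb{N}_+$ and $m\geqslant 2$ an integer. Then there exist at most $\sum_{i=1}^k a_i-1$ consecutive values of $n\in\mathbb{N}$ such that $p_\mathcal{A}(n,k)\equiv 0\pmod{m}$; that is, there is no $n_0\in\mathbb{N}$ with $p_\mathcal{A}(n,k)\equiv0\pmod m$ for all $n\in\{n_0,n_0+1,\ldots,n_0+\sum_{i=1}^ka_i-1\}$.
   Context: $\mathbb{N}=\{0,1,2,\ldots\}$. For $k\in\mathbb{N}_+$ and $n\in\mathbb{N}$, $p_\mathcal{A}(n,k)$ is the number of tuples $(x_1,\ldots,x_k)\in\mathbb{N}^k$ with $a_1x_1+\cdots+a_kx_k=n$, i.e. $\sum_{n\ge0}p_\mathcal{A}(n,k)x^n=\prod_{i=1}^k(1-x^{a_i})^{-1}$. *)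

theory Defs
  imports "HOL-Library.FuncSet" "HOL-Number_Theory.Cong"
begin

text \<open>
  The sequence is indexed by the positive integers, so the value \<open>a 0\<close> is never used.
  The tuple \<open>(x\<^sub>1, \<dots>, x\<^sub>k)\<close> is an extensional function on \<open>{1..k}\<close>, so that each tuple
  is counted exactly once.
\<close>

definition partition_tuples :: "(nat \<Rightarrow> nat) \<Rightarrow> nat \<Rightarrow> nat \<Rightarrow> (nat \<Rightarrow> nat) set" where
  "partition_tuples a n k = {x \<in> {1..k} \<rightarrow>\<^sub>E (UNIV :: nat set). (\<Sum>i=1..k. a i * x i) = n}"

definition p_restricted :: "(nat \<Rightarrow> nat) \<Rightarrow> nat \<Rightarrow> nat \<Rightarrow> nat" where
  "p_restricted a n k = card (partition_tuples a n k)"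

lemma finite_partition_tuples:
  assumes "\<And>i. i \<ge> 1 \<Longrightarrow> a i > 0"
  shows "finite (partition_tuples a n k)"
proof (rule finite_subset)
  show "partition_tuples a n k \<subseteq> {1..k} \<rightarrow>\<^sub>E {..n}"
  proof
    fix x assume x: "x \<in> partition_tuples a n k"
    have "x i \<le> n" if i: "i \<in> {1..k}" for i
    proof -
      have "x i \<le> a i * x i" using assms[of i] i by simp
      also have "\<dots> \<le> (\<Sum>i=1..k. a i * x i)" using i by (intro member_le_sum) auto
      finally show ?thesis using x by (simp add: partition_tuples_def)
    qed
    with x show "x \<in> {1..k} \<rightarrow>\<^sub>E {..n}" by (auto simp: partition_tuples_def PiE_iff)
  qed
qed (intro finite_PiE, auto)

end

theory Submission
  imports Defs
begin

text \<open>
  Splitting on whether the last part is used gives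
  \<open>p(n + a\<^sub>k, k) = p(n + a\<^sub>k, k - 1) + p(n, k)\<close>. Hence if \<open>p(\<cdot>, k)\<close> vanishes modulo \<open>m\<close> on a window
  of \<open>a\<^sub>1 + \<dots> + a\<^sub>k\<close> consecutive integers, then \<open>p(\<cdot>, k - 1)\<close> vanishes on that window with its
  first \<open>a\<^sub>k\<close> elements removed. Descending to \<open>k = 1\<close> leaves a window of \<open>a\<^sub>1\<close> consecutive integers,
  which contains a multiple of \<open>a\<^sub>1\<close>, where \<open>p(\<cdot>, 1)\<close> equals 1.
\<close>

lemma sum_mult_fun_upd_Suc:
  fixes a x :: "nat \<Rightarrow> nat"
  shows "(\<Sum>i=1..Suc k. a i * (x(Suc k := v)) i) = (\<Sum>i=1..k. a i * x i) + a (Suc k) * v"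
proof -
  have "(\<Sum>i=1..k. a i * (x(Suc k := v)) i) = (\<Sum>i=1..k. a i * x i)"
    by (intro sum.cong) auto
  then show ?thesis by simp
qed

text \<open>The two images are the tuples whose last entry is zero and those whose last entry is
  positive. Writing the total as \<open>n + a (Suc k)\<close> avoids truncated subtraction.\<close>

lemma partition_tuples_Suc:
  "partition_tuples a (n + a (Suc k)) (Suc k) =
     (\<lambda>x. x(Suc k := 0)) ` partition_tuples a (n + a (Suc k)) k \<union>
     (\<lambda>x. x(Suc k := Suc (x (Suc k)))) ` partition_tuples a n (Suc k)"
  (is "?L = ?A \<union> ?B")
proof (intro equalityI subsetI)
  fix x assume x: "x \<in> ?L"
  have ext: "x i = undefined" if "i \<notin> {1..Suc k}" for i
    using x that by (auto simp: partition_tuples_def PiE_iff extensional_def)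
  have sum: "(\<Sum>i=1..k. a i * x i) + a (Suc k) * x (Suc k) = n + a (Suc k)"
    using x by (simp add: partition_tuples_def)
  show "x \<in> ?A \<union> ?B"
  proof (cases "x (Suc k)")
    case 0
    \<comment> \<open>Tuples of length \<open>k\<close> are extensional on \<open>{1..k}\<close>, so
      the dropped entry must become \<open>undefined\<close>.\<close>
    define y where "y = x(Suc k := undefined)"
    have "(\<Sum>i=1..k. a i * y i) = (\<Sum>i=1..k. a i * x i)"
      unfolding y_def by (intro sum.cong) auto
    then have "y \<in> partition_tuples a (n + a (Suc k)) k"
      using sum 0 ext by (auto simp: partition_tuples_def PiE_iff extensional_def y_def)
    moreover have "x = y(Suc k := 0)"
      using 0 by (auto simp: y_def)
    ultimately show ?thesis by blast
  next
    case (Suc v)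
    define y where "y = x(Suc k := v)"
    have "(\<Sum>i=1..Suc k. a i * y i) = n"
      using sum Suc unfolding y_def sum_mult_fun_upd_Suc by simp
    then have "y \<in> partition_tuples a n (Suc k)"
      using ext by (auto simp: partition_tuples_def PiE_iff extensional_def y_def)
    moreover have "x = y(Suc k := Suc (y (Suc k)))"
      using Suc by (auto simp: y_def)
    ultimately show ?thesis by blast
  qed
next
  fix x assume "x \<in> ?A \<union> ?B"
  then show "x \<in> ?L"
  proof
    assume "x \<in> ?A"
    then obtain y where y: "y \<in> partition_tuples a (n + a (Suc k)) k" "x = y(Suc k := 0)"
      by blast
    have "(\<Sum>i=1..Suc k. a i * x i) = n + a (Suc k)"
      using y(1) unfolding y(2) sum_mult_fun_upd_Suc by (simp add: partition_tuples_def)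
    then show ?thesis
      using y by (auto simp: partition_tuples_def PiE_iff extensional_def)
  next
    assume "x \<in> ?B"
    then obtain y where y: "y \<in> partition_tuples a n (Suc k)" "x = y(Suc k := Suc (y (Suc k)))"
      by blast
    have "(\<Sum>i=1..Suc k. a i * x i) = n + a (Suc k)"
      using y(1) unfolding y(2) sum_mult_fun_upd_Suc by (simp add: partition_tuples_def)
    then show ?thesis
      using y by (auto simp: partition_tuples_def PiE_iff extensional_def)
  qed
qed

lemma p_restricted_Suc:
  assumes "\<And>i. i \<ge> 1 \<Longrightarrow> a i > 0"
  shows "p_restricted a (n + a (Suc k)) (Suc k) =
           p_restricted a (n + a (Suc k)) k + p_restricted a n (Suc k)"
proof -
  have "inj_on (\<lambda>x. x(Suc k := 0)) (partition_tuples a (n + a (Suc k)) k)"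
  proof (rule inj_onI, rule ext)
    fix x y i
    assume "x \<in> partition_tuples a (n + a (Suc k)) k" "y \<in> partition_tuples a (n + a (Suc k)) k"
      and eq: "x(Suc k := 0) = y(Suc k := 0)"
    \<comment> \<open>The update erases this entry, but both values are \<open>undefined\<close> by
      extensionality.\<close>
    then have "x (Suc k) = y (Suc k)"
      by (auto simp: partition_tuples_def PiE_iff extensional_def)
    with fun_cong[OF eq, of i] show "x i = y i" by (auto split: if_splits)
  qed
  moreover have "inj_on (\<lambda>x. x(Suc k := Suc (x (Suc k)))) (partition_tuples a n (Suc k))"
  proof (rule inj_onI, rule ext)
    fix x y :: "nat \<Rightarrow> nat" and i
    assume eq: "x(Suc k := Suc (x (Suc k))) = y(Suc k := Suc (y (Suc k)))"
    show "x i = y i" using fun_cong[OF eq, of i] by (auto split: if_splits)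
  qed
  moreover have "(\<lambda>x. x(Suc k := 0)) ` partition_tuples a (n + a (Suc k)) k \<inter>
      (\<lambda>x. x(Suc k := Suc (x (Suc k)))) ` partition_tuples a n (Suc k) = {}"
    \<comment> \<open>At \<open>Suc k\<close> one side is 0 and the other a successor.\<close>
    by (auto dest: fun_cong[of _ _ "Suc k"])
  ultimately show ?thesis
    unfolding p_restricted_def partition_tuples_Suc
    using finite_partition_tuples[OF assms] by (simp add: card_Un_disjoint card_image)
qed

text \<open>Cancelling \<open>a 1\<close> in \<open>a 1 * x 1 = a 1 * q\<close> leaves only
  \<open>x 1 = q\<close>.\<close>

lemma p_restricted_1_multiple:
  assumes "a 1 > 0"
  shows "p_restricted a (a 1 * q) 1 = 1"
proof -
  have "partition_tuples a (a 1 * q) 1 = {\<lambda>i\<in>{1}. q}"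
    using assms by (fastforce simp: partition_tuples_def PiE_iff extensional_def)
  then show ?thesis by (simp add: p_restricted_def)
qed

lemma exists_not_dvd_p_restricted:
  assumes pos: "\<And>i. i \<ge> 1 \<Longrightarrow> a i > 0" and "k \<ge> 1" and "m \<ge> 2"
  shows "\<exists>n. n0 \<le> n \<and> n < n0 + (\<Sum>i=1..k. a i) \<and> \<not> m dvd p_restricted a n k"
  using \<open>k \<ge> 1\<close>
proof (induction k arbitrary: n0 rule: dec_induct)
  case base
  \<comment> \<open>The least multiple of \<open>a 1\<close> that is at least \<open>n0\<close>, by
    rounding the quotient up.\<close>
  define n where "n = a 1 * ((n0 + a 1 - 1) div a 1)"
  have "n + (n0 + a 1 - 1) mod a 1 = n0 + a 1 - 1"
    unfolding n_def by (rule mult_div_mod_eq)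
  moreover have "(n0 + a 1 - 1) mod a 1 < a 1"
    using pos[of 1] by simp
  ultimately have "n0 \<le> n" "n < n0 + a 1"
    using pos[of 1] by linarith+
  moreover have "\<not> m dvd p_restricted a n 1"
    using \<open>m \<ge> 2\<close> unfolding n_def p_restricted_1_multiple[of a, OF pos[OF order_refl]] by simp
  ultimately show ?case by auto
next
  case (step k)
  \<comment> \<open>The induction hypothesis is used for the window starting at
    \<open>n0 + a (Suc k)\<close>, so that both \<open>n\<close> and \<open>n - a (Suc k)\<close>
    lie in the window for \<open>Suc k\<close>.\<close>
  obtain n where n: "n0 + a (Suc k) \<le> n" "n < n0 + a (Suc k) + (\<Sum>i=1..k. a i)"
    and ndvd: "\<not> m dvd p_restricted a n k"
    using step.IH by blast
  define l where "l = n - a (Suc k)"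
  have n_eq: "n = l + a (Suc k)" using n by (simp add: l_def)
  have "p_restricted a n (Suc k) = p_restricted a n k + p_restricted a l (Suc k)"
    unfolding n_eq by (rule p_restricted_Suc[OF pos])
  \<comment> \<open>If \<open>m\<close> divided both counts, it would divide their difference
    \<open>p_restricted a n k\<close>.\<close>
  with ndvd have "\<not> m dvd p_restricted a n (Suc k) \<or> \<not> m dvd p_restricted a l (Suc k)"
    by (auto simp: dvd_add_left_iff)
  moreover have "n0 \<le> l" "l < n0 + (\<Sum>i=1..Suc k. a i)"
    "n0 \<le> n" "n < n0 + (\<Sum>i=1..Suc k. a i)"
    using n by (auto simp: n_eq)
  ultimately show ?case by blast
qed

theorem theorem5p1:
  fixes a :: "nat \<Rightarrow> nat" and k m :: nat
  assumes "\<And>i. i \<ge> 1 \<Longrightarrow> a i > 0"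
    and "k \<ge> 1"
    and "m \<ge> 2"
  shows "\<not> (\<exists>n0::nat. \<forall>n \<in> {n0..n0 + (\<Sum>i=1..k. a i) - 1}. [p_restricted a n k = 0] (mod m))"
proof
  assume "\<exists>n0. \<forall>n \<in> {n0..n0 + (\<Sum>i=1..k. a i) - 1}. [p_restricted a n k = 0] (mod m)"
  then obtain n0 where
    zero: "\<forall>n \<in> {n0..n0 + (\<Sum>i=1..k. a i) - 1}. [p_restricted a n k = 0] (mod m)"
    by blast
  obtain n where "n0 \<le> n" "n < n0 + (\<Sum>i=1..k. a i)" "\<not> m dvd p_restricted a n k"
    using exists_not_dvd_p_restricted[of a k m n0, OF assms] by blast
  with zero show False by (auto simp: cong_0_iff)
qed

end
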